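(* For each fixed $x>0$, $$\lim_{s\to\infty}\frac{\Phi_{2s}(x)}{\Phi_{2s-}(x)}=1.$$
   Context: Let $\Gamma_r(t)=re^{it}$, $t\in[0,2\pi]$, with $r>1$. Define, for integers $s\ge 0$, $$\Phi_{2s}(x):=\frac{1}{2\pi i}\int_{\Gamma_r}\frac{e^{xz}}{(z-1)^{s+1}(z+1)^{s}}\,dz,\qquad \Phi_{2s-}(x):=\frac{1}{2\pi i}\int_{\Gamma_r}\frac{e^{xz}}{(z-1)^{s}(z+1)^{s+1}}\,dz.$$ Both functions are strictly positive for $x>0$. *)

theory Defs
  imports "HOL-Complex_Analysis.Complex_Analysis"
begin

(* The contour is the library's "circlepath 0 r", i.e. t in [0,1] maps to
   r * exp (2 * pi * i * t): the circle r * exp (i * t), t in [0, 2 * pi], with the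
   parameter rescaled. For r > 1 both integrands are continuous on it, so the total
   function contour_integral does not return its default value.

   Phi r s x is Phi_{2s}(x), and Phi_minus r s x is Phi_{2s-}(x): the index is s,
   not 2s. *)

definition Phi :: "real \<Rightarrow> nat \<Rightarrow> real \<Rightarrow> complex" where
  "Phi r s x =
     1 / (2 * of_real pi * \<i>) *
     contour_integral (circlepath 0 r)
       (\<lambda>z. exp (of_real x * z) / ((z - 1) ^ (s + 1) * (z + 1) ^ s))"

definition Phi_minus :: "real \<Rightarrow> nat \<Rightarrow> real \<Rightarrow> complex" where
  "Phi_minus r s x =
     1 / (2 * of_real pi * \<i>) *
     contour_integral (circlepath 0 r)
       (\<lambda>z. exp (of_real x * z) / ((z - 1) ^ s * (z + 1) ^ (s + 1)))"

end

theory Submission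
  imports Defs
begin

text \<open>
  Over the common denominator \<open>(z\<^sup>2 - 1) ^ (s + 1)\<close> the two numerators are
  \<open>exp (x z) (z + 1)\<close> and \<open>exp (x z) (z - 1)\<close>. Hence the two functions are \<open>A + B\<close> and
  \<open>A - B\<close>, where \<open>A\<close> and \<open>B\<close> are the integrals with numerators \<open>z exp (x z)\<close> and
  \<open>exp (x z)\<close>. Expanding the denominator in powers of \<open>1 / z\<^sup>2\<close> and integrating termwise
  turns both into series with positive terms, and the \<open>k\<close>-th term of \<open>B\<close> is
  \<open>x / (2 s + 2 k + 1)\<close> times that of \<open>A\<close>. So \<open>0 < B / A \<le> x / (2 s + 1)\<close>, which tends to \<open>0\<close>.
\<close>

lemma higher_deriv_exp_mult:
  "(deriv ^^ n) (\<lambda>z. exp (c * z)) = (\<lambda>z. c ^ n * exp (c * z))" for c :: complex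
proof (induction n)
  case (Suc n)
  have "deriv (\<lambda>z. c ^ n * exp (c * z)) z = c ^ Suc n * exp (c * z)" for z
    by (rule DERIV_imp_deriv) (auto intro!: derivative_eq_intros)
  with Suc show ?case by auto
qed simp

text \<open>Cauchy's integral formula at \<open>0\<close> for the \<open>n\<close>-th derivative of
  \<open>exp (c * z)\<close>, which takes the value \<open>c ^ n\<close> there.\<close>

lemma has_contour_integral_exp_div_power:
  assumes "r > 0"
  shows "((\<lambda>z. exp (c * z) / z ^ Suc n) has_contour_integral
           2 * of_real pi * \<i> * (c ^ n / fact n)) (circlepath 0 r)"
  using Cauchy_has_contour_integral_higher_derivative_circlepath
    [of 0 r "\<lambda>z. exp (c * z)" 0 n] assms
  by (simp add: higher_deriv_exp_mult continuous_intros holomorphic_intros)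

text \<open>Newton's binomial series with exponent \<open>- (s + 1)\<close>, taken at
  \<open>- w\<close>: the sign \<open>(-1) ^ k\<close> in the generalized binomial coefficient
  cancels the one in \<open>(- w) ^ k\<close>.\<close>

lemma negative_binomial_sums:
  fixes w :: complex
  assumes "norm w < 1"
  shows "(\<lambda>k. of_nat ((s + k) choose k) * w ^ k) sums (1 / (1 - w) ^ Suc s)"
proof -
  have ne: "1 - w \<noteq> 0"
    using assms by auto
  have "(\<lambda>k. ((- (of_nat s + 1)) gchoose k) * (- w) ^ k) sums
          (1 + (- w)) powr (- (of_nat s + 1))"
    by (rule gen_binomial_complex) (use assms in simp)
  also have "(\<lambda>k. ((- (of_nat s + 1)) gchoose k) * (- w) ^ k) =
             (\<lambda>k. of_nat ((s + k) choose k) * w ^ k)"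
    unfolding binomial_gbinomial of_nat_add gbinomial_minus' power_minus[of w]
    by (simp only: mult_ac)
  also have "(1 + (- w)) powr (- (of_nat s + 1)) = (1 - w) powr (- of_nat (Suc s))"
    by (simp add: add.commute)
  also have "\<dots> = 1 / (1 - w) ^ Suc s"
    using ne by (subst powr_minus_divide, subst powr_nat') simp_all
  finally show ?thesis .
qed

text \<open>On the circle \<open>w = 1 / z ^ 2\<close> has norm \<open>1 / r ^ 2 < 1\<close>, so the
  last factor expands as a negative binomial series. Convergence is uniform there, and Cauchy's
  formula evaluates each term.\<close>

lemma contour_integral_exp_sums:
  fixes c :: complex and r :: real
  assumes "r > 1"
  shows "(\<lambda>k. of_nat ((s + k) choose k) * (c ^ (2 * k + n) / fact (2 * k + n))) sums
           (1 / (2 * of_real pi * \<i>) * contour_integral (circlepath 0 r)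
             (\<lambda>z. exp (c * z) / z ^ Suc n * (1 / (1 - 1 / z ^ 2) ^ Suc s)))"
proof -
  define g where "g = (\<lambda>z::complex. exp (c * z) / z ^ Suc n)"
  define t where "t = (\<lambda>k (z::complex). of_nat ((s + k) choose k) * (exp (c * z) / z ^ Suc (2 * k + n)))"
  have t_eq: "t k z = g z * (of_nat ((s + k) choose k) * (1 / z ^ 2) ^ k)" for k z
  proof -
    have "z ^ Suc (2 * k + n) = z ^ Suc n * (z ^ 2) ^ k"
      by (simp only: power_mult[symmetric] power_add[symmetric]) (simp add: add.commute)
    then show ?thesis
      by (simp only: t_def g_def power_one_over) simp
  qed
  have w: "norm (1 / z ^ 2) = 1 / r ^ 2" "1 / r ^ 2 < 1" if "z \<in> sphere 0 r" for z :: complex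
    using that assms by (simp_all add: norm_divide norm_power)
  \<comment> \<open>\<open>M\<close> bounds \<open>g\<close>, the factor of \<open>t k z\<close>
    that does not depend on \<open>k\<close>.\<close>
  have "compact (g ` sphere 0 r)"
    unfolding g_def by (intro compact_continuous_image continuous_intros) (use assms in auto)
  then have "bounded (g ` sphere 0 r)"
    by (rule compact_imp_bounded)
  then obtain M where M: "norm (g z) \<le> M" if "z \<in> sphere 0 r" for z
    unfolding bounded_iff by blast
  have int: "(t k has_contour_integral of_nat ((s + k) choose k) *
          (2 * of_real pi * \<i> * (c ^ (2 * k + n) / fact (2 * k + n)))) (circlepath 0 r)" for k
    unfolding t_def
    by (intro has_contour_integral_lmul has_contour_integral_exp_div_power) (use assms in simp)
  have ul: "uniform_limit (sphere 0 r) (\<lambda>m z. \<Sum>k<m. t k z)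
          (\<lambda>z. \<Sum>k. t k z) sequentially"
  proof (rule Weierstrass_m_test)
    show "norm (t k z) \<le> M * (real ((s + k) choose k) * (1 / r ^ 2) ^ k)"
      if "z \<in> sphere 0 r" for k z
      unfolding t_eq norm_mult norm_power w(1)[OF that] norm_of_nat
      by (intro mult_right_mono M that) (use assms in simp)
    \<comment> \<open>The majorant is again a negative binomial series, now at the real point
      \<open>1 / r ^ 2\<close>; its summability is obtained over the complex numbers and carried
      back to the reals.\<close>
    have "norm (of_real (1 / r ^ 2) :: complex) < 1"
      using assms by (simp only: norm_of_real) simp
    from negative_binomial_sums[OF this, of s]
    have "summable (\<lambda>k. complex_of_real (real ((s + k) choose k) * (1 / r ^ 2) ^ k))"
      by (simp add: sums_iff)
    then show "summable (\<lambda>k. M * (real ((s + k) choose k) * (1 / r ^ 2) ^ k))"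
      by (intro summable_mult) (simp only: summable_complex_of_real)
  qed
  have "(\<Sum>k. t k z) = g z * (1 / (1 - 1 / z ^ 2) ^ Suc s)" if "z \<in> sphere 0 r" for z
    using sums_mult[OF negative_binomial_sums[of "1 / z ^ 2" s], of "g z"] w[OF that]
    unfolding t_eq by (simp add: sums_iff)
  then have ul': "uniform_limit (sphere 0 r) (\<lambda>m z. \<Sum>k<m. t k z)
          (\<lambda>z. g z * (1 / (1 - 1 / z ^ 2) ^ Suc s)) sequentially"
    by (intro uniform_limit_cong'[THEN iffD1, OF refl _ ul])
  have int_sum: "((\<lambda>z. \<Sum>k<m. t k z) has_contour_integral
       (\<Sum>k<m. of_nat ((s + k) choose k) *
          (2 * of_real pi * \<i> * (c ^ (2 * k + n) / fact (2 * k + n))))) (circlepath 0 r)" for m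
    by (intro has_contour_integral_sum int) auto
  have "(\<lambda>m. contour_integral (circlepath 0 r) (\<lambda>z. \<Sum>k<m. t k z)) \<longlonglongrightarrow>
      contour_integral (circlepath 0 r) (\<lambda>z. g z * (1 / (1 - 1 / z ^ 2) ^ Suc s))"
  proof (rule contour_integral_uniform_limit_circlepath(2)[OF always_eventually ul'])
    show "\<forall>m. (\<lambda>z. \<Sum>k<m. t k z) contour_integrable_on circlepath 0 r"
      using int_sum has_contour_integral_integrable by blast
  qed (use assms in simp_all)
  then have "(\<lambda>k. of_nat ((s + k) choose k) *
          (2 * of_real pi * \<i> * (c ^ (2 * k + n) / fact (2 * k + n)))) sums
      contour_integral (circlepath 0 r) (\<lambda>z. g z * (1 / (1 - 1 / z ^ 2) ^ Suc s))"
    by (simp add: contour_integral_unique[OF int_sum] sums_def)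
  from sums_mult[OF this, of "1 / (2 * of_real pi * \<i>)"] show ?thesis
    by (simp add: g_def field_simps)
qed

text \<open>The residue series above at real \<open>c = x\<close>. The sum for
  \<open>n = 2 * s\<close> is \<open>A\<close>, the sum for \<open>n = 2 * s + 1\<close> is
  \<open>B\<close>.\<close>

definition coeff_series :: "nat \<Rightarrow> nat \<Rightarrow> real \<Rightarrow> nat \<Rightarrow> real" where
  "coeff_series n s x k = real ((s + k) choose k) * (x ^ (2 * k + n) / fact (2 * k + n))"

lemma summable_coeff_series: "summable (coeff_series n s x)"
proof -
  have "summable (\<lambda>k. complex_of_real (coeff_series n s x k))"
    \<comment> \<open>The terms do not involve the radius, so any value above \<open>1\<close>
      serves; \<open>2\<close> is a choice.\<close>
    using contour_integral_exp_sums[of 2 s "of_real x" n]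
    by (simp add: coeff_series_def sums_iff)
  then show ?thesis
    by (simp only: summable_complex_of_real)
qed

lemma contour_integral_eq_coeff_series:
  assumes "r > 1"
  shows "1 / (2 * of_real pi * \<i>) * contour_integral (circlepath 0 r)
             (\<lambda>z. exp (of_real x * z) / z ^ Suc n * (1 / (1 - 1 / z ^ 2) ^ Suc s)) =
         of_real (\<Sum>k. coeff_series n s x k)"
proof -
  have "(\<lambda>k. complex_of_real (coeff_series n s x k)) sums of_real (\<Sum>k. coeff_series n s x k)"
    by (intro sums_of_real summable_sums summable_coeff_series)
  then show ?thesis
    using contour_integral_exp_sums[OF assms, of s "of_real x" n]
    by (intro sums_unique2) (simp_all add: coeff_series_def)
qed

text \<open>Clearing \<open>1 / z ^ 2\<close> from the denominator produces
  \<open>z ^ (2 * s + 2)\<close>. Against \<open>z ^ Suc n\<close> this leaves a factor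
  \<open>z\<close> for \<open>n = 2 * s\<close> and \<open>1\<close> for
  \<open>n = 2 * s + 1\<close>, which gives the two halves of the numerators \<open>z + 1\<close>
  and \<open>z - 1\<close>.\<close>

lemma
  assumes "r > 1"
  shows Phi_eq_coeff_series: "Phi r s x = of_real ((\<Sum>k. coeff_series (2 * s) s x k) + (\<Sum>k. coeff_series (2 * s + 1) s x k))"
    and Phi_minus_eq_coeff_series: "Phi_minus r s x =
           of_real ((\<Sum>k. coeff_series (2 * s) s x k) - (\<Sum>k. coeff_series (2 * s + 1) s x k))"
proof -
  define F where "F = (\<lambda>n (z::complex). exp (of_real x * z) / z ^ Suc n * (1 / (1 - 1 / z ^ 2) ^ Suc s))"
  have nz: "z \<noteq> 0 \<and> z ^ 2 \<noteq> 1" if "z \<in> sphere 0 r" for z :: complex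
  proof -
    have "norm (z ^ 2) = r ^ 2"
      using that by (simp add: norm_power)
    moreover have "r ^ 2 > 1"
      by (rule one_less_power) (use assms in simp_all)
    ultimately have "z ^ 2 \<noteq> 1"
      by (metis norm_one less_irrefl)
    moreover have "z \<noteq> 0"
      using that assms by auto
    ultimately show ?thesis by simp
  qed
  have F_eq: "F (2 * s) z = exp (of_real x * z) * z / (z ^ 2 - 1) ^ Suc s"
    "F (2 * s + 1) z = exp (of_real x * z) / (z ^ 2 - 1) ^ Suc s"
    if "z \<in> sphere 0 r" for z
  proof -
    have "1 - 1 / z ^ 2 = (z ^ 2 - 1) / z ^ 2"
      using nz[OF that] by (simp add: field_simps)
    then have "1 / (1 - 1 / z ^ 2) ^ Suc s = z ^ (2 * Suc s) / (z ^ 2 - 1) ^ Suc s"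
      by (simp only: power_divide power_mult divide_divide_eq_right mult_1_left)
    then have *: "F n z = exp (of_real x * z) / z ^ Suc n * (z ^ (2 * Suc s) / (z ^ 2 - 1) ^ Suc s)" for n
      by (simp only: F_def)
    have **: "z ^ (2 * Suc s) = z ^ Suc (2 * s) * z" "z ^ (2 * Suc s) = z ^ Suc (2 * s + 1)"
      by simp_all
    have cancel: "a / p * (p * q / D) = a * q / D" if "p \<noteq> 0" for a p q D :: complex
      using that by simp
    have p: "z ^ m \<noteq> 0" for m
      using nz[OF that] by simp
    show "F (2 * s) z = exp (of_real x * z) * z / (z ^ 2 - 1) ^ Suc s"
      unfolding * **(1) by (rule cancel[OF p])
    show "F (2 * s + 1) z = exp (of_real x * z) / (z ^ 2 - 1) ^ Suc s"
      unfolding * **(2) using cancel[OF p, of _ _ 1] by (simp only: mult_1_right)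
  qed
  have path: "path_image (circlepath 0 r) = sphere 0 r"
    using assms by simp
  have F_int: "F n contour_integrable_on circlepath 0 r" for n
  proof (rule contour_integrable_continuous_circlepath)
    have "(1 - 1 / z ^ 2) ^ Suc s \<noteq> 0" if "z \<in> sphere 0 r" for z :: complex
      using nz[OF that] by (auto simp: field_simps)
    then show "continuous_on (path_image (circlepath 0 r)) (F n)"
      unfolding F_def path using nz by (intro continuous_intros) auto
  qed
  have F_value: "1 / (2 * of_real pi * \<i>) * contour_integral (circlepath 0 r) (F n) =
      of_real (\<Sum>k. coeff_series n s x k)" for n
    unfolding F_def by (rule contour_integral_eq_coeff_series[OF assms])
  \<comment> \<open>Each fraction is extended by its missing linear factor, which is nonzero because
    \<open>z ^ 2 \<noteq> 1\<close> on the circle.\<close>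
  have frac: "a / ((z - 1) ^ (s + 1) * (z + 1) ^ s) = a * (z + 1) / (z ^ 2 - 1) ^ Suc s"
    "a / ((z - 1) ^ s * (z + 1) ^ (s + 1)) = a * (z - 1) / (z ^ 2 - 1) ^ Suc s"
    if "z \<in> sphere 0 r" for a z :: complex
  proof -
    have f: "z ^ 2 - 1 = (z - 1) * (z + 1)"
      by (simp add: power2_eq_square algebra_simps)
    have "z - 1 \<noteq> 0" "z + 1 \<noteq> 0"
      using nz[OF that] f by auto
    then show "a / ((z - 1) ^ (s + 1) * (z + 1) ^ s) = a * (z + 1) / (z ^ 2 - 1) ^ Suc s"
      "a / ((z - 1) ^ s * (z + 1) ^ (s + 1)) = a * (z - 1) / (z ^ 2 - 1) ^ Suc s"
      unfolding f power_mult_distrib by simp_all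
  qed
  have "contour_integral (circlepath 0 r)
          (\<lambda>z. exp (of_real x * z) / ((z - 1) ^ (s + 1) * (z + 1) ^ s)) =
        contour_integral (circlepath 0 r) (\<lambda>z. F (2 * s) z + F (2 * s + 1) z)"
    by (rule contour_integral_eq)
      (simp only: path F_eq frac distrib_left add_divide_distrib mult_1_right)
  then show "Phi r s x = of_real ((\<Sum>k. coeff_series (2 * s) s x k) + (\<Sum>k. coeff_series (2 * s + 1) s x k))"
    unfolding Phi_def
    by (simp only: F_value contour_integral_add F_int distrib_left of_real_add)
  have "contour_integral (circlepath 0 r)
          (\<lambda>z. exp (of_real x * z) / ((z - 1) ^ s * (z + 1) ^ (s + 1))) =
        contour_integral (circlepath 0 r) (\<lambda>z. F (2 * s) z - F (2 * s + 1) z)"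
    by (rule contour_integral_eq)
      (simp only: path F_eq frac right_diff_distrib diff_divide_distrib mult_1_right)
  then show "Phi_minus r s x =
      of_real ((\<Sum>k. coeff_series (2 * s) s x k) - (\<Sum>k. coeff_series (2 * s + 1) s x k))"
    unfolding Phi_minus_def
    by (simp only: F_value contour_integral_diff F_int right_diff_distrib of_real_diff)
qed

lemma suminf_coeff_series_pos:
  assumes "x > 0"
  shows "(\<Sum>k. coeff_series n s x k) > 0"
  by (rule suminf_pos[OF summable_coeff_series]) (use assms in \<open>simp add: coeff_series_def\<close>)

text \<open>The comparison is termwise: the quotient of the \<open>k\<close>-th terms is
  \<open>x / (2 * k + n + 1)\<close>, which is largest at \<open>k = 0\<close>.\<close>

lemma suminf_coeff_series_Suc_le:
  assumes "x > 0"
  shows "(\<Sum>k. coeff_series (n + 1) s x k) \<le> x / real (n + 1) * (\<Sum>k. coeff_series n s x k)"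
proof -
  have "coeff_series (n + 1) s x k \<le> x / real (n + 1) * coeff_series n s x k" for k
  proof -
    have "coeff_series (n + 1) s x k = x / real (2 * k + n + 1) * coeff_series n s x k"
      by (simp add: coeff_series_def field_simps)
    also have "\<dots> \<le> x / real (n + 1) * coeff_series n s x k"
      using assms by (intro mult_right_mono divide_left_mono) (auto simp: coeff_series_def)
    finally show ?thesis .
  qed
  then show ?thesis
    unfolding suminf_mult[OF summable_coeff_series, symmetric]
    by (intro suminf_le summable_mult summable_coeff_series)
qed

theorem corollary12:
  fixes r x :: real
  assumes "r > 1" and "x > 0"
  shows "(\<lambda>s. Phi r s x / Phi_minus r s x) \<longlonglongrightarrow> 1"
proof -
  define A B where "A s = (\<Sum>k. coeff_series (2 * s) s x k)"
    and "B s = (\<Sum>k. coeff_series (2 * s + 1) s x k)" for s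
  have pos: "A s > 0" "B s > 0" for s
    unfolding A_def B_def by (rule suminf_coeff_series_pos[OF assms(2)])+
  have le: "norm (B s / A s) \<le> x / real (2 * s + 1)" for s
    using suminf_coeff_series_Suc_le[OF assms(2), of "2 * s" s] pos[of s]
    by (simp add: A_def B_def pos_divide_le_eq)
  have lim0: "(\<lambda>s. x / real (2 * s + 1)) \<longlonglongrightarrow> 0"
    by real_asymp
  have lim: "(\<lambda>s. B s / A s) \<longlonglongrightarrow> 0"
    by (rule Lim_null_comparison[OF always_eventually lim0]) (use le in blast)
  have "(\<lambda>s. complex_of_real ((1 + B s / A s) / (1 - B s / A s))) \<longlonglongrightarrow>
          of_real ((1 + 0) / (1 - 0))"
    by (intro tendsto_intros lim) simp
  moreover have "Phi r s x / Phi_minus r s x =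
      of_real ((1 + B s / A s) / (1 - B s / A s))" for s
  proof -
    \<comment> \<open>Cancelling \<open>A s\<close> takes only \<open>A s > 0\<close>: if
      \<open>A s = B s\<close>, both sides are \<open>0\<close>, since division by zero yields
      \<open>0\<close>.\<close>
    have "(1 + B s / A s) / (1 - B s / A s) = (A s + B s) / (A s - B s)"
      using pos(1)[of s] by (simp add: add_divide_eq_iff diff_divide_eq_iff)
    then show ?thesis
      by (simp only: Phi_eq_coeff_series[OF assms(1)] Phi_minus_eq_coeff_series[OF assms(1)] A_def B_def of_real_divide)
  qed
  ultimately show ?thesis by simp
qed

end
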